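(* Let $A\in\mathbb{R}_+^{m\times n}$ be an entrywise nonnegative matrix of (classical) rank $3$. Then the nonnegative rank of $A$ does not exceed $\left\lceil\frac{6\min\{m,n\}}{7}\right\rceil$.
   Context: The nonnegative rank of a nonnegative matrix $A\in\mathbb{R}_+^{m\times n}$ is the smallest integer $k$ such that $A=BC$ for some entrywise nonnegative $B\in\mathbb{R}_+^{m\times k}$ and $C\in\mathbb{R}_+^{k\times n}$. *)

theory Defs
  imports Complex_Main "Jordan_Normal_Form.DL_Rank"
begin

definition nonneg_mat :: "real mat \<Rightarrow> bool" where
  "nonneg_mat A \<longleftrightarrow> (\<forall>i < dim_row A. \<forall>j < dim_col A. 0 \<le> A $$ (i, j))"

definition nonneg_factorization :: "real mat \<Rightarrow> nat \<Rightarrow> bool" where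
  "nonneg_factorization A k \<longleftrightarrow>
     (\<exists>B \<in> carrier_mat (dim_row A) k. \<exists>C \<in> carrier_mat k (dim_col A).
        nonneg_mat B \<and> nonneg_mat C \<and> A = B * C)"

text \<open>Meaningful for nonnegative matrices only: the set of admissible \<open>k\<close> is then
  nonempty by the lemma below, so the minimum is attained.\<close>

definition nonneg_rank :: "real mat \<Rightarrow> nat" where
  "nonneg_rank A = (LEAST k. nonneg_factorization A k)"

lemma nonneg_factorization_dim_col:
  assumes "nonneg_mat A"
  shows "nonneg_factorization A (dim_col A)"
  unfolding nonneg_factorization_def
proof (intro bexI conjI)
  show "nonneg_mat A" by (fact assms)
  show "nonneg_mat (1\<^sub>m (dim_col A))" by (auto simp: nonneg_mat_def)
  show "A = A * 1\<^sub>m (dim_col A)" by (simp add: right_mult_one_mat')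
qed auto

end

theory Submission
  imports Defs
begin

text \<open>Split the columns into blocks of seven; it suffices that a nonnegative matrix with seven
  columns and rank at most three has a factorization of size six (transposing gives the bound by
  the rows). If a column is a conic combination of the others, drop it. Otherwise the columns,
  scaled to sum one, are the vertices \<open>v\<^sub>0, \<dots>, v\<^sub>6\<close> of a convex heptagon in an affine plane, on
  which the rows are affine functions. Look for vectors \<open>p\<^sub>1, p\<^sub>2, p\<^sub>3\<close> and \<open>q\<^sub>1, q\<^sub>2, q\<^sub>3\<close> such
  that every \<open>p\<^sub>i + q\<^sub>j\<close> lies in the cone over the heptagon and seven of these nine sums are
  positive multiples of the vertices. For each row \<open>f\<close> there is then a constant \<open>c\<close> with
  \<open>f p\<^sub>i + c \<ge> 0\<close> and \<open>f q\<^sub>j - c \<ge> 0\<close> for all \<open>i\<close> and \<open>j\<close>, which yields the factorization (the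
  heptagon is a plane section of a polytope with six vertices). The seven proportionality
  conditions are solved by the linear relations between four vertices. The two remaining sums lie
  in the cone if two determinant ratios are at least one, and the Pluecker relations force this
  for one of the seven cyclic labellings of the vertices.\<close>

section \<open>Nonnegative factorizations over index sets and their closure properties\<close>

text \<open>Functions on arbitrary row and column sets replace matrices, so that selecting seven
  columns, relabelling and transposing need no index arithmetic.\<close>

definition nn_fac :: "'r set \<Rightarrow> 'c set \<Rightarrow> nat \<Rightarrow> ('r \<Rightarrow> 'c \<Rightarrow> real) \<Rightarrow> bool" where
  "nn_fac R J k a \<longleftrightarrow>
     (\<exists>B C. (\<forall>i\<in>R. \<forall>t<k. 0 \<le> B i t) \<and> (\<forall>t<k. \<forall>j\<in>J. 0 \<le> C t j) \<and>
        (\<forall>i\<in>R. \<forall>j\<in>J. a i j = (\<Sum>t<k. B i t * C t j)))"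

lemma nn_facI:
  assumes "\<And>i t. i \<in> R \<Longrightarrow> t < k \<Longrightarrow> 0 \<le> B i t"
    and "\<And>t j. t < k \<Longrightarrow> j \<in> J \<Longrightarrow> 0 \<le> C t j"
    and "\<And>i j. i \<in> R \<Longrightarrow> j \<in> J \<Longrightarrow> a i j = (\<Sum>t<k. B i t * C t j)"
  shows "nn_fac R J k a"
  unfolding nn_fac_def using assms by blast

lemma nn_facE:
  assumes "nn_fac R J k a"
  obtains B C where "\<And>i t. i \<in> R \<Longrightarrow> t < k \<Longrightarrow> 0 \<le> B i t"
    and "\<And>t j. t < k \<Longrightarrow> j \<in> J \<Longrightarrow> 0 \<le> C t j"
    and "\<And>i j. i \<in> R \<Longrightarrow> j \<in> J \<Longrightarrow> a i j = (\<Sum>t<k. B i t * C t j)"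
  using assms unfolding nn_fac_def by blast

lemma nn_fac_transpose:
  assumes "nn_fac R J k a"
  shows "nn_fac J R k (\<lambda>j i. a i j)"
proof -
  obtain B C where "\<And>i t. i \<in> R \<Longrightarrow> t < k \<Longrightarrow> 0 \<le> B i t"
    and "\<And>t j. t < k \<Longrightarrow> j \<in> J \<Longrightarrow> 0 \<le> C t j"
    and "\<And>i j. i \<in> R \<Longrightarrow> j \<in> J \<Longrightarrow> a i j = (\<Sum>t<k. B i t * C t j)"
    by (rule nn_facE[OF assms]) blast
  then show ?thesis
    by (intro nn_facI[where B = "\<lambda>j t. C t j" and C = "\<lambda>t i. B i t"]) (auto simp: mult.commute)
qed

lemma nn_fac_Un:
  assumes "nn_fac R J k a" and "nn_fac R J' k' a"
  shows "nn_fac R (J \<union> J') (k + k') a"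
proof -
  obtain B C where B: "\<And>i t. i \<in> R \<Longrightarrow> t < k \<Longrightarrow> 0 \<le> B i t"
    and C: "\<And>t j. t < k \<Longrightarrow> j \<in> J \<Longrightarrow> 0 \<le> C t j"
    and BC: "\<And>i j. i \<in> R \<Longrightarrow> j \<in> J \<Longrightarrow> a i j = (\<Sum>t<k. B i t * C t j)"
    by (rule nn_facE[OF assms(1)]) blast
  obtain B' C' where B': "\<And>i t. i \<in> R \<Longrightarrow> t < k' \<Longrightarrow> 0 \<le> B' i t"
    and C': "\<And>t j. t < k' \<Longrightarrow> j \<in> J' \<Longrightarrow> 0 \<le> C' t j"
    and BC': "\<And>i j. i \<in> R \<Longrightarrow> j \<in> J' \<Longrightarrow> a i j = (\<Sum>t<k'. B' i t * C' t j)"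
    by (rule nn_facE[OF assms(2)]) blast
  define E where "E i t = (if t < k then B i t else B' i (t - k))" for i t
  \<comment> \<open>A column in both sets is produced by the first factorization alone, so
    \<open>J\<close> and \<open>J'\<close> may overlap.\<close>
  define F where "F t j = (if t < k then if j \<in> J then C t j else 0
      else if j \<in> J then 0 else C' (t - k) j)" for t j
  have split: "(\<Sum>t<k+k'. f t) = (\<Sum>t<k. f t) + (\<Sum>t<k'. f (t + k))" for f :: "nat \<Rightarrow> real"
  proof -
    have "(\<Sum>t<k+k'. f t) = (\<Sum>t<k. f t) + (\<Sum>t=k..<k+k'. f t)"
      by (simp add: lessThan_atLeast0 sum.atLeastLessThan_concat)
    also have "(\<Sum>t=k..<k+k'. f t) = (\<Sum>t<k'. f (t + k))"
      using sum.shift_bounds_nat_ivl[of f 0 k k'] by (simp add: lessThan_atLeast0 add.commute)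
    finally show ?thesis .
  qed
  show ?thesis
  proof (rule nn_facI[where B = E and C = F])
    show "a i j = (\<Sum>t<k + k'. E i t * F t j)" if "i \<in> R" "j \<in> J \<union> J'" for i j
    proof (cases "j \<in> J")
      case True
      have "a i j = (\<Sum>t<k. B i t * C t j)"
        using BC that(1) True by blast
      with True show ?thesis
        by (simp add: split E_def F_def)
    next
      case False
      have "a i j = (\<Sum>t<k'. B' i t * C' t j)"
        using BC' that False by blast
      with False show ?thesis
        by (simp add: split E_def F_def)
    qed
    show "0 \<le> E i t" if "i \<in> R" "t < k + k'" for i t
      using that B[of i t] B'[of i "t - k"] by (simp add: E_def)
    show "0 \<le> F t j" if "t < k + k'" "j \<in> J \<union> J'" for t j
      using that C[of t j] C'[of "t - k" j] by (auto simp: F_def)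
  qed
qed

lemma nn_fac_cong:
  assumes "nn_fac R J k a" and "\<And>i j. i \<in> R \<Longrightarrow> j \<in> J \<Longrightarrow> a i j = b i j"
  shows "nn_fac R J k b"
proof (rule nn_facE[OF assms(1)])
  fix B C
  assume "\<And>i t. i \<in> R \<Longrightarrow> t < k \<Longrightarrow> 0 \<le> B i t"
    and "\<And>t j. t < k \<Longrightarrow> j \<in> J \<Longrightarrow> 0 \<le> C t j"
    and "\<And>i j. i \<in> R \<Longrightarrow> j \<in> J \<Longrightarrow> a i j = (\<Sum>t<k. B i t * C t j)"
  then show ?thesis
    using assms(2) by (intro nn_facI[where B = B and C = C]) metis+
qed

lemma nn_fac_image:
  assumes "nn_fac R J k (\<lambda>i j. a i (h j))"
  shows "nn_fac R (h ` J) k a"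
proof -
  obtain B C where B: "\<And>i t. i \<in> R \<Longrightarrow> t < k \<Longrightarrow> 0 \<le> B i t"
    and C: "\<And>t j. t < k \<Longrightarrow> j \<in> J \<Longrightarrow> 0 \<le> C t j"
    and BC: "\<And>i j. i \<in> R \<Longrightarrow> j \<in> J \<Longrightarrow> a i (h j) = (\<Sum>t<k. B i t * C t j)"
    by (rule nn_facE[OF assms]) blast
  define g where "g = inv_into J h"
  have g: "g j \<in> J" "h (g j) = j" if "j \<in> h ` J" for j
    using that by (simp_all add: g_def inv_into_into f_inv_into_f)
  show ?thesis
  proof (rule nn_facI[where B = B and C = "\<lambda>t j. C t (g j)"])
    show "a i j = (\<Sum>t<k. B i t * C t (g j))" if "i \<in> R" "j \<in> h ` J" for i j
      using BC[OF that(1) g(1)[OF that(2)]] g(2)[OF that(2)] by simp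
  qed (use B C g in auto)
qed

lemma nn_fac_card:
  assumes "finite J" and "\<And>i j. i \<in> R \<Longrightarrow> j \<in> J \<Longrightarrow> 0 \<le> a i j"
  shows "nn_fac R J (card J) a"
proof -
  obtain h where h: "bij_betw h {..<card J} J"
    using assms(1) ex_bij_betw_nat_finite by (metis lessThan_atLeast0)
  have "nn_fac R {..<card J} (card J) (\<lambda>i j. a i (h j))"
    using assms(2) bij_betwE[OF h]
    by (intro nn_facI[where B = "\<lambda>i t. a i (h t)" and C = "\<lambda>t j. of_bool (t = j)"]) auto
  from nn_fac_image[where a = a and h = h, OF this] show ?thesis
    using h by (simp add: bij_betw_def)
qed

text \<open>Column \<open>j0\<close> comes for free: its coefficients are the same conic combination
  of the coefficient columns of the others. Three terms suffice in the plane, and repeated indices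
  cover degenerate triangles and zero columns.\<close>

lemma nn_fac_conic:
  assumes "finite J" and "\<And>i j. i \<in> R \<Longrightarrow> j \<in> J \<Longrightarrow> 0 \<le> a i j"
    and "j0 \<in> J" and "j1 \<in> J - {j0}" and "j2 \<in> J - {j0}" and "j3 \<in> J - {j0}"
    and "0 \<le> c1" and "0 \<le> c2" and "0 \<le> c3"
    and comb: "\<And>i. i \<in> R \<Longrightarrow> a i j0 = c1 * a i j1 + c2 * a i j2 + c3 * a i j3"
  shows "nn_fac R J (card J - 1) a"
proof -
  have "nn_fac R (J - {j0}) (card (J - {j0})) a"
    using assms(1,2) by (intro nn_fac_card) auto
  moreover have "card (J - {j0}) = card J - 1"
    using assms(1,3) by simp
  ultimately have "nn_fac R (J - {j0}) (card J - 1) a"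
    by simp
  then obtain B C where B: "\<And>i t. i \<in> R \<Longrightarrow> t < card J - 1 \<Longrightarrow> 0 \<le> B i t"
    and C: "\<And>t j. t < card J - 1 \<Longrightarrow> j \<in> J - {j0} \<Longrightarrow> 0 \<le> C t j"
    and BC: "\<And>i j. i \<in> R \<Longrightarrow> j \<in> J - {j0} \<Longrightarrow> a i j = (\<Sum>t<card J - 1. B i t * C t j)"
    by (rule nn_facE) blast
  define D where "D t j = (if j = j0 then c1 * C t j1 + c2 * C t j2 + c3 * C t j3 else C t j)" for t j
  show ?thesis
  proof (rule nn_facI[where B = B and C = D])
    show "0 \<le> D t j" if "t < card J - 1" "j \<in> J" for t j
      using that C[of t j] C[of t j1] C[of t j2] C[of t j3] assms(4-9) by (auto simp: D_def)
    show "a i j = (\<Sum>t<card J - 1. B i t * D t j)" if "i \<in> R" "j \<in> J" for i j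
    proof (cases "j = j0")
      case True
      show ?thesis
        unfolding True comb[OF \<open>i \<in> R\<close>] BC[OF \<open>i \<in> R\<close> assms(4)] BC[OF \<open>i \<in> R\<close> assms(5)]
          BC[OF \<open>i \<in> R\<close> assms(6)]
        by (simp add: D_def sum_distrib_left sum.distrib distrib_left mult.left_commute)
    next
      case False
      then show ?thesis using BC that by (simp add: D_def)
    qed
  qed (use B in auto)
qed

text \<open>Each full block of seven columns costs six, and each of the \<open>n mod 7\<close>
  columns left over costs one.\<close>

lemma nn_fac_blocks:
  fixes a :: "'r \<Rightarrow> nat \<Rightarrow> real"
  assumes "\<And>i j. i \<in> R \<Longrightarrow> j < n \<Longrightarrow> 0 \<le> a i j"
    and "\<And>J. J \<subseteq> {..<n} \<Longrightarrow> card J = 7 \<Longrightarrow> nn_fac R J 6 a"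
  shows "nn_fac R {..<n} (n - n div 7) a"
  using assms
proof (induction n rule: less_induct)
  case (less n)
  show ?case
  proof (cases "n < 7")
    case True
    then show ?thesis using nn_fac_card[of "{..<n}" R a] less.prems(1) by simp
  next
    case False
    have "nn_fac R {..<n - 7} (n - 7 - (n - 7) div 7) a"
    proof (rule less.IH)
      show "nn_fac R J 6 a" if "J \<subseteq> {..<n - 7}" "card J = 7" for J
        using less.prems(2)[of J] that by force
    qed (use False less.prems(1) in auto)
    moreover have "nn_fac R {n - 7..<n} 6 a"
      using False by (intro less.prems(2)) auto
    ultimately have "nn_fac R ({..<n - 7} \<union> {n - 7..<n}) (n - 7 - (n - 7) div 7 + 6) a"
      by (rule nn_fac_Un)
    moreover have "{..<n - 7} \<union> {n - 7..<n} = {..<n}"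
      by auto
    moreover have "n - 7 - (n - 7) div 7 + 6 = n - n div 7"
      using False by (auto simp: le_div_geq)
    ultimately show ?thesis by simp
  qed
qed

section \<open>Oriented triangle areas in the plane and their Pluecker relations\<close>

definition orient :: "('a \<Rightarrow> real) \<Rightarrow> ('a \<Rightarrow> real) \<Rightarrow> 'a \<Rightarrow> 'a \<Rightarrow> 'a \<Rightarrow> real" where
  "orient x y i j k = (x j - x i) * (y k - y i) - (x k - x i) * (y j - y i)"

lemma orient_rotate: "orient x y i j k = orient x y j k i"
  by (simp add: orient_def algebra_simps)

lemma orient_swap: "orient x y i k j = - orient x y i j k"
  by (simp add: orient_def algebra_simps)

text \<open>Cramer's rule: the signed 3-by-3 minors are the coefficients of a linear relation
  between the four vectors \<open>(1, x, y)\<close>, and an affine function of the points is a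
  linear functional of these vectors.\<close>

lemma orient_affine:
  "orient x y j k l * (al + be * x i + ga * y i) - orient x y i k l * (al + be * x j + ga * y j)
    + orient x y i j l * (al + be * x k + ga * y k) - orient x y i j k * (al + be * x l + ga * y l) = 0"
  by (simp add: orient_def algebra_simps)

text \<open>Three-term Grassmann-Pluecker relations; the point common to all factors is
  \<open>j\<close>, \<open>m\<close>, \<open>k\<close>, \<open>l\<close> in turn. The signs are
  arranged so that every factor is positive if \<open>i < j < k < l < m\<close> label a convex
  polygon counterclockwise.\<close>

lemma orient_plucker:
  "orient x y i j l * orient x y j k m =
    orient x y i j k * orient x y j l m + orient x y i j m * orient x y j k l"
  "orient x y j l m * orient x y i k m =
    orient x y j k m * orient x y i l m + orient x y k l m * orient x y i j m"
  "orient x y i k l * orient x y j k m =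
    orient x y i j k * orient x y k l m + orient x y i k m * orient x y j k l"
  "orient x y j l m * orient x y i k l =
    orient x y j k l * orient x y i l m + orient x y i j l * orient x y k l m"
  by (simp_all add: orient_def algebra_simps)

text \<open>The two hypotheses give \<open>p i * q i > 1\<close> and \<open>q i * p (i + 3) > 1\<close>. So if no index is good,
  then \<open>q i < 1\<close> implies \<open>q (i + 3) < 1\<close>, and as 3 generates the residues modulo 7, either all
  \<open>q i\<close> or all \<open>p i\<close> are below 1; both contradict the hypotheses.\<close>

lemma periodic_both_ge_one:
  fixes p q :: "nat \<Rightarrow> real"
  assumes p: "\<And>i. 0 < p i" and q: "\<And>i. 0 < q i"
    and per: "\<And>i. p (i + 7) = p i" "\<And>i. q (i + 7) = q i"
    and pq: "\<And>i. q i < p (i + 1) * p (i + 2)"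
    and qp: "\<And>i. p (i + 2) < q i * q (i + 1)"
  shows "\<exists>i. 1 \<le> p i \<and> 1 \<le> q i"
proof (rule ccontr)
  assume none: "\<not> (\<exists>i. 1 \<le> p i \<and> 1 \<le> q i)"
  have 1: "1 < p i * q i" for i
  proof -
    \<comment> \<open>\<open>i + 6\<close> serves as \<open>i - 1\<close> modulo 7.\<close>
    have "p (i + 7 + 1) < q (i + 6) * q (i + 7)"
      using qp[of "i + 6"] by (simp add: eval_nat_numeral)
    moreover have "q (i + 6) < p (i + 7) * p (i + 7 + 1)"
      using pq[of "i + 6"] by (simp add: eval_nat_numeral)
    then have "q (i + 6) * q (i + 7) < p (i + 7) * p (i + 7 + 1) * q (i + 7)"
      using q by (simp add: mult_strict_right_mono)
    ultimately have "p (i + 7 + 1) < p (i + 7) * p (i + 7 + 1) * q (i + 7)"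
      by (rule less_trans)
    then have "p (i + 7 + 1) * 1 < p (i + 7 + 1) * (p (i + 7) * q (i + 7))"
      by (simp add: mult.assoc mult.left_commute)
    then have "1 < p (i + 7) * q (i + 7)"
      using p[of "i + 7 + 1"] by (simp only: mult_less_cancel_left_pos)
    then show ?thesis by (simp only: per)
  qed
  have 2: "1 < q i * p (i + 3)" for i
  proof -
    have "q (i + 1) < p (i + 2) * p (i + 3)"
      using pq[of "i + 1"] by (simp add: eval_nat_numeral)
    also have "\<dots> < q i * q (i + 1) * p (i + 3)"
      using qp[of i] p by (simp add: mult_strict_right_mono)
    finally have "q (i + 1) * 1 < q (i + 1) * (q i * p (i + 3))"
      by (simp add: mult.assoc mult.left_commute)
    then show ?thesis
      using q[of "i + 1"] by (simp only: mult_less_cancel_left_pos)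
  qed
  have lt1: "a * b < 1" if "a < 1" "b \<le> 1" "0 < a" for a b :: real
    using that mult_left_le[of b a] by linarith
  have step: "q (i + 3) < 1" if "q i < 1" for i
  proof -
    have "1 < p (i + 3)"
      using lt1[of "q i" "p (i + 3)"] that 2[of i] q[of i] by linarith
    with none show ?thesis by (meson less_imp_le not_le)
  qed
  show False
  proof (cases "\<exists>i. q i < 1")
    case True
    then obtain i where i: "q i < 1" ..
    have steps: "q (i + 3 * k) < 1" for k
    proof (induction k)
      case (Suc k)
      from step[OF this] show ?case by (simp add: algebra_simps)
    qed (use i in simp)
    \<comment> \<open>Five steps reach \<open>i + 15\<close>, congruent to \<open>i + 1\<close>
      modulo 7; below, three steps reach \<open>i + 9\<close>, congruent to
      \<open>i + 2\<close>.\<close>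
    have "q (i + 1) < 1"
      using steps[of 5] per(2)[of "i + 1"] per(2)[of "i + 8"] by (simp add: add.commute)
    then have "q i * q (i + 1) < 1"
      using lt1[OF i] q[of i] by simp
    moreover have "q (i + 2) < 1"
      using steps[of 3] per(2)[of "i + 2"] by (simp add: add.commute)
    then have "1 < p (i + 2)"
      using lt1[of "q (i + 2)" "p (i + 2)"] 1[of "i + 2", unfolded mult.commute[of "p (i + 2)"]]
        q[of "i + 2"] by linarith
    ultimately show False using qp[of i] by linarith
  next
    case False
    then have q1: "1 \<le> q i" for i
      by (meson not_le)
    then have p1: "p i < 1" for i
      using none by (meson not_le)
    have "p (0 + 1) * p (0 + 2) < 1"
      using lt1[OF p1 less_imp_le[OF p1] p] .
    then show False using pq[of 0] q1[of 0] by linarith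
  qed
qed

text \<open>Insertion sort for a relation that is total and transitive on \<open>S\<close> only. It
  serves for the angular order around a point, which is not transitive on the whole plane.\<close>

lemma sorted_enumeration:
  assumes "finite S"
    and "\<And>i j. i \<in> S \<Longrightarrow> j \<in> S \<Longrightarrow> i \<noteq> j \<Longrightarrow> r i j \<or> r j i"
    and "\<And>i j k. i \<in> S \<Longrightarrow> j \<in> S \<Longrightarrow> k \<in> S \<Longrightarrow> r i j \<Longrightarrow> r j k \<Longrightarrow> r i k"
  shows "\<exists>xs. distinct xs \<and> set xs = S \<and> sorted_wrt r xs"
  using assms
proof (induction S rule: finite_induct)
  case empty
  show ?case by simp
next
  case (insert x S)
  have "\<exists>xs. distinct xs \<and> set xs = S \<and> sorted_wrt r xs"
  proof (rule insert.IH)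
    show "r i j \<or> r j i" if "i \<in> S" "j \<in> S" "i \<noteq> j" for i j
      using insert.prems(1)[of i j] that by simp
    show "r i k" if "i \<in> S" "j \<in> S" "k \<in> S" "r i j" "r j k" for i j k
      using insert.prems(2)[of i j k] that by simp
  qed
  then obtain xs where xs: "distinct xs" "set xs = S" "sorted_wrt r xs"
    by blast
  let ?L = "filter (\<lambda>y. r y x) xs" and ?U = "filter (\<lambda>y. \<not> r y x) xs"
  have U: "r x y" if "y \<in> set ?U" for y
    using that insert.prems(1)[of x y] insert.hyps(2) xs(2) by auto
  have LU: "r y z" if "y \<in> set ?L" "z \<in> set ?U" for y z
    using insert.prems(2)[of y x z] U[of z] that xs(2) by simp
  have "sorted_wrt r (?L @ x # ?U)"
    unfolding sorted_wrt_append sorted_wrt.simps list.set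
  proof (intro conjI ballI)
    show "sorted_wrt r ?L" "sorted_wrt r ?U"
      using xs(3) by (simp_all add: sorted_wrt_filter)
    show "r y z" if "y \<in> set ?L" "z \<in> insert x (set ?U)" for y z
      using LU[of y z] that by (cases "z = x") simp_all
  qed (fact U)
  moreover have "distinct (?L @ x # ?U)" "set (?L @ x # ?U) = insert x S"
    using xs(1,2) insert.hyps(2) by auto
  ultimately show ?case by blast
qed

section \<open>Factorization of size six for a well-placed convex heptagon\<close>

text \<open>For \<open>b i j = l j * a i j\<close>, row \<open>i\<close> takes the values
  \<open>0\<close>, \<open>b i 2 - b i 1\<close>, \<open>b i 4 - b i 0\<close> on
  \<open>p\<^sub>1, p\<^sub>2, p\<^sub>3\<close> and \<open>b i 1\<close>, \<open>b i 0\<close>,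
  \<open>b i 6\<close> on \<open>q\<^sub>1, q\<^sub>2, q\<^sub>3\<close>. The equations identify
  \<open>p\<^sub>2 + q\<^sub>2\<close> and \<open>p\<^sub>3 + q\<^sub>3\<close> with vertices 3 and
  5; the inequalities make the two sums that are not vertices, \<open>p\<^sub>3 + q\<^sub>1\<close>
  and \<open>p\<^sub>2 + q\<^sub>3\<close>, nonnegative.\<close>

lemma nn_fac_bipartite_seven:
  fixes a :: "'r \<Rightarrow> nat \<Rightarrow> real" and l :: "nat \<Rightarrow> real"
  assumes l: "\<And>j. j < 7 \<Longrightarrow> 0 < l j"
    and a: "\<And>i j. i \<in> R \<Longrightarrow> j < 7 \<Longrightarrow> 0 \<le> a i j"
    and eq: "\<And>i. i \<in> R \<Longrightarrow> l 1 * a i 1 + l 3 * a i 3 = l 2 * a i 2 + l 0 * a i 0"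
      "\<And>i. i \<in> R \<Longrightarrow> l 0 * a i 0 + l 5 * a i 5 = l 4 * a i 4 + l 6 * a i 6"
    and ge: "\<And>i. i \<in> R \<Longrightarrow> l 0 * a i 0 \<le> l 1 * a i 1 + l 4 * a i 4"
      "\<And>i. i \<in> R \<Longrightarrow> l 0 * a i 0 \<le> l 3 * a i 3 + l 6 * a i 6"
  shows "nn_fac R {..<7} 6 a"
proof -
  define b where "b i j = l j * a i j" for i j
  \<comment> \<open>The largest of the values \<open>- p\<^sub>i\<close>: each
    \<open>q\<^sub>j - c\<close> is then one of the sums \<open>p\<^sub>i + q\<^sub>j\<close>, hence
    nonnegative.\<close>
  define c where "c i = max 0 (max (b i 1 - b i 2) (b i 0 - b i 4))" for i
  \<comment> \<open>normalising \<open>p\<^sub>1 = 0\<close>, the entries are \<open>p\<^sub>1, p\<^sub>2, p\<^sub>3\<close> shifted by \<open>c\<close> and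
      \<open>q\<^sub>1, q\<^sub>2, q\<^sub>3\<close> shifted by \<open>- c\<close>\<close>
  define B where "B i t = [c i, b i 2 - b i 1 + c i, b i 4 - b i 0 + c i,
      b i 1 - c i, b i 0 - c i, b i 6 - c i] ! t" for i t
  \<comment> \<open>Vertex \<open>j\<close> is an edge between \<open>{0, 1, 2}\<close> (the
    \<open>p\<close>) and \<open>{3, 4, 5}\<close> (the \<open>q\<close>); the edges
    \<open>{2, 3}\<close> and \<open>{1, 5}\<close> are left out.\<close>
  define e :: "nat \<Rightarrow> nat set" where
    "e j = [{0, 4}, {0, 3}, {1, 3}, {1, 4}, {2, 4}, {2, 5}, {0, 5}] ! j" for j
  have b: "0 \<le> b i j" if "i \<in> R" "j < 7" for i j
    using that l[of j] a[of i j] by (simp add: b_def)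
  have eqb: "b i 1 + b i 3 = b i 2 + b i 0" "b i 0 + b i 5 = b i 4 + b i 6"
      "b i 0 \<le> b i 1 + b i 4" "b i 0 \<le> b i 3 + b i 6" if "i \<in> R" for i
    using eq[OF that] ge[OF that] by (simp_all add: b_def)
  have less6: "t \<in> {0, 1, 2, 3, 4, 5}" if "t < 6" for t :: nat
    using that by auto
  have less7: "j \<in> {0, 1, 2, 3, 4, 5, 6}" if "j < 7" for j :: nat
    using that by auto
  show ?thesis
  proof (rule nn_facI[where B = B and C = "\<lambda>t j. of_bool (t \<in> e j) / l j"])
    show "0 \<le> B i t" if "i \<in> R" "t < 6" for i t
      using less6[OF that(2)] eqb[OF that(1)] b[OF that(1), of 0] b[OF that(1), of 1]
        b[OF that(1), of 2] b[OF that(1), of 3] b[OF that(1), of 4] b[OF that(1), of 5]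
        b[OF that(1), of 6]
      by (auto simp: B_def c_def)
    show "0 \<le> of_bool (t \<in> e j) / l j" if "j \<in> {..<7}" for t j
      using that l[of j] by simp
    show "a i j = (\<Sum>t<6. B i t * (of_bool (t \<in> e j) / l j))" if "i \<in> R" "j \<in> {..<7}" for i j
    proof -
      have "(\<Sum>t<6. B i t * of_bool (t \<in> e j)) = b i j"
        using less7[of j] that eqb(1,2)[OF that(1)]
        by (auto simp: B_def e_def eval_nat_numeral)
      moreover have "(\<Sum>t<6. B i t * (of_bool (t \<in> e j) / l j)) = (\<Sum>t<6. B i t * of_bool (t \<in> e j)) / l j"
        unfolding sum_divide_distrib by (rule sum.cong) simp_all
      ultimately show ?thesis
        using l[of j] that(2) by (simp add: b_def)
    qed
  qed
qed

text \<open>The two sums that are not vertices lie in the cones over the triangles 1, 2, 4 and 3, 5,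
  6. In each case only one of the three weights has a sign not forced by convexity, and
  \<open>good\<close> supplies it.\<close>

lemma nn_fac_good_heptagon:
  fixes x y :: "nat \<Rightarrow> real"
  assumes pos: "\<And>i j k. i < j \<Longrightarrow> j < k \<Longrightarrow> k < 7 \<Longrightarrow> 0 < orient x y i j k"
    and good: "orient x y 0 1 2 * orient x y 4 5 6 \<le> orient x y 1 2 4 * orient x y 0 5 6"
      "orient x y 0 5 6 * orient x y 1 2 3 \<le> orient x y 3 5 6 * orient x y 0 1 2"
    and a: "\<And>i j. a i j = al i + be i * x j + ga i * y j"
    and nonneg: "\<And>i j. i \<in> R \<Longrightarrow> j < 7 \<Longrightarrow> 0 \<le> a i j"
  shows "nn_fac R {..<7} 6 a"
proof -
  let ?o = "orient x y"
  \<comment> \<open>the weights in the linear relations between the vertices 0, 1, 2, 3 and 0, 4, 5, 6, scaled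
      to agree at 0\<close>
  define l where "l j = [?o 1 2 3 * ?o 4 5 6, ?o 0 2 3 * ?o 4 5 6, ?o 0 1 3 * ?o 4 5 6,
      ?o 0 1 2 * ?o 4 5 6, ?o 0 5 6 * ?o 1 2 3, ?o 0 4 6 * ?o 1 2 3, ?o 0 4 5 * ?o 1 2 3] ! j" for j
  note l_simps = l_def[of 0] l_def[of 1] l_def[of 2] l_def[of 3] l_def[of 4] l_def[of 5] l_def[of 6]
    l_def[of "Suc 0"]
  have rel: "?o j k m * a i h - ?o h k m * a i j + ?o h j m * a i k - ?o h j k * a i m = 0" for h i j k m
    unfolding a by (rule orient_affine)
  have less7: "j \<in> {0, 1, 2, 3, 4, 5, 6}" if "j < 7" for j :: nat
    using that by auto
  show ?thesis
  proof (rule nn_fac_bipartite_seven[where l = l])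
    show "0 < l j" if "j < 7" for j
      using less7[OF that] by (auto simp: l_simps pos)
    show "l 1 * a i 1 + l 3 * a i 3 = l 2 * a i 2 + l 0 * a i 0" for i
    proof -
      have "l 1 * a i 1 + l 3 * a i 3 - (l 2 * a i 2 + l 0 * a i 0) =
          - (?o 1 2 3 * a i 0 - ?o 0 2 3 * a i 1 + ?o 0 1 3 * a i 2 - ?o 0 1 2 * a i 3) * ?o 4 5 6"
        by (simp add: l_simps algebra_simps)
      then show ?thesis unfolding rel by simp
    qed
    show "l 0 * a i 0 + l 5 * a i 5 = l 4 * a i 4 + l 6 * a i 6" for i
    proof -
      have "l 0 * a i 0 + l 5 * a i 5 - (l 4 * a i 4 + l 6 * a i 6) =
          (?o 4 5 6 * a i 0 - ?o 0 5 6 * a i 4 + ?o 0 4 6 * a i 5 - ?o 0 4 5 * a i 6) * ?o 1 2 3"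
        by (simp add: l_simps algebra_simps)
      then show ?thesis unfolding rel by simp
    qed
    show "l 0 * a i 0 \<le> l 1 * a i 1 + l 4 * a i 4" if "i \<in> R" for i
    proof -
      \<comment> \<open>The relation of 0, 1, 2, 4 eliminates vertex 0. A Pluecker relation makes
        the weight of vertex 1 positive, and \<open>good(1)\<close> makes that of vertex 4
        nonnegative.\<close>
      have "?o 1 2 4 * (l 1 * a i 1 + l 4 * a i 4 - l 0 * a i 0) =
          (?o 1 2 4 * l 1 - ?o 0 2 4 * l 0) * a i 1 + l 0 * ?o 0 1 4 * a i 2
          + (?o 1 2 4 * l 4 - ?o 0 1 2 * l 0) * a i 4
          - l 0 * (?o 1 2 4 * a i 0 - ?o 0 2 4 * a i 1 + ?o 0 1 4 * a i 2 - ?o 0 1 2 * a i 4)"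
        by (simp add: algebra_simps)
      also have "?o 1 2 4 * l 1 - ?o 0 2 4 * l 0 =
          (?o 0 2 3 * ?o 1 2 4 - ?o 0 2 4 * ?o 1 2 3) * ?o 4 5 6"
        by (simp add: l_simps algebra_simps)
      also have "?o 0 2 3 * ?o 1 2 4 - ?o 0 2 4 * ?o 1 2 3 = ?o 0 1 2 * ?o 2 3 4"
        unfolding orient_plucker(3)[of x y 0 2 3 1 4] by simp
      also have "?o 1 2 4 * l 4 - ?o 0 1 2 * l 0 =
          (?o 1 2 4 * ?o 0 5 6 - ?o 0 1 2 * ?o 4 5 6) * ?o 1 2 3"
        by (simp add: l_simps algebra_simps)
      finally have "0 \<le> ?o 1 2 4 * (l 1 * a i 1 + l 4 * a i 4 - l 0 * a i 0)"
        unfolding rel using good(1) nonneg[OF that] by (simp add: l_simps pos less_imp_le)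
      then show ?thesis
        using pos[of 1 2 4] by (simp add: zero_le_mult_iff)
    qed
    show "l 0 * a i 0 \<le> l 3 * a i 3 + l 6 * a i 6" if "i \<in> R" for i
    proof -
      \<comment> \<open>The mirror image, with the relation of 0, 3, 5, 6: the weight of vertex 6
        comes from a Pluecker relation and that of vertex 3 from \<open>good(2)\<close>.\<close>
      have "?o 3 5 6 * (l 3 * a i 3 + l 6 * a i 6 - l 0 * a i 0) =
          (?o 3 5 6 * l 3 - ?o 0 5 6 * l 0) * a i 3 + l 0 * ?o 0 3 6 * a i 5
          + (?o 3 5 6 * l 6 - ?o 0 3 5 * l 0) * a i 6
          - l 0 * (?o 3 5 6 * a i 0 - ?o 0 5 6 * a i 3 + ?o 0 3 6 * a i 5 - ?o 0 3 5 * a i 6)"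
        by (simp add: algebra_simps)
      also have "?o 3 5 6 * l 6 - ?o 0 3 5 * l 0 =
          (?o 3 5 6 * ?o 0 4 5 - ?o 0 3 5 * ?o 4 5 6) * ?o 1 2 3"
        by (simp add: l_simps algebra_simps)
      also have "?o 3 5 6 * ?o 0 4 5 - ?o 0 3 5 * ?o 4 5 6 = ?o 3 4 5 * ?o 0 5 6"
        unfolding orient_plucker(4)[of x y 3 5 6 0 4] by simp
      also have "?o 3 5 6 * l 3 - ?o 0 5 6 * l 0 =
          (?o 3 5 6 * ?o 0 1 2 - ?o 0 5 6 * ?o 1 2 3) * ?o 4 5 6"
        by (simp add: l_simps algebra_simps)
      finally have "0 \<le> ?o 3 5 6 * (l 3 * a i 3 + l 6 * a i 6 - l 0 * a i 0)"
        unfolding rel using good(2) nonneg[OF that] by (simp add: l_simps pos less_imp_le)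
      then show ?thesis
        using pos[of 3 5 6] by (simp add: zero_le_mult_iff)
    qed
  qed (use nonneg in auto)
qed

section \<open>Cyclic relabelling of a convex heptagon\<close>

text \<open>Reducing modulo 7 an increasing triple that spans less than a period gives an increasing
  triple up to cyclic rotation, and rotation preserves \<open>orient\<close>.\<close>

lemma orient_periodic_pos:
  fixes x y :: "nat \<Rightarrow> real"
  assumes pos: "\<And>i j k. i < j \<Longrightarrow> j < k \<Longrightarrow> k < 7 \<Longrightarrow> 0 < orient x y i j k"
    and per: "\<And>i. x (i + 7) = x i" "\<And>i. y (i + 7) = y i"
    and ijk: "i < j" "j < k" "k < i + 7"
  shows "0 < orient x y i j k"
proof -
  have per': "orient x y (i + 7) j k = orient x y i j k" "orient x y i (j + 7) k = orient x y i j k"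
    "orient x y i j (k + 7) = orient x y i j k" for i j k
    by (simp_all add: orient_def per)
  show ?thesis
    using ijk
  proof (induction i arbitrary: j k rule: less_induct)
    case (less i)
    show ?case
    proof (cases "i < 7")
      case False
      then obtain i' j' k' where "i = i' + 7" "j = j' + 7" "k = k' + 7"
        using less.prems by (metis add.commute le_Suc_ex less_imp_le not_less order_trans)
      then show ?thesis using less.IH[of i' j' k'] less.prems by (simp add: per')
    next
      case True
      consider "k < 7" | k' where "k = k' + 7" "j < 7" | j' k' where "j = j' + 7" "k = k' + 7"
        using less.prems by (metis add.commute le_Suc_ex less_imp_le not_less order_trans)
      then show ?thesis
      proof cases
        case 1
        then show ?thesis using pos less.prems by simp
      next
        case 2
        then have "0 < orient x y k' i j" using pos less.prems by simp
        then show ?thesis using 2 by (simp add: per' orient_rotate[of x y k'])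
      next
        case 3
        then have "0 < orient x y j' k' i" using pos less.prems True by simp
        then show ?thesis using 3 by (simp add: per' orient_rotate[of x y i])
      qed
    qed
  qed
qed

text \<open>The ratios \<open>p s\<close> and \<open>q s\<close> of the two sides fit
  \<open>periodic_both_ge_one\<close>: in both product inequalities common factors cancel, and what
  is left is a Pluecker relation with a positive term dropped.\<close>

lemma good_rotation:
  fixes x y :: "nat \<Rightarrow> real"
  assumes pos: "\<And>i j k. i < j \<Longrightarrow> j < k \<Longrightarrow> k < i + 7 \<Longrightarrow> 0 < orient x y i j k"
    and per: "\<And>i. x (i + 7) = x i" "\<And>i. y (i + 7) = y i"
  shows "\<exists>s. orient x y s (s + 1) (s + 2) * orient x y (s + 4) (s + 5) (s + 6)
        \<le> orient x y (s + 1) (s + 2) (s + 4) * orient x y s (s + 5) (s + 6) \<and>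
      orient x y s (s + 5) (s + 6) * orient x y (s + 1) (s + 2) (s + 3)
        \<le> orient x y (s + 3) (s + 5) (s + 6) * orient x y s (s + 1) (s + 2)"
proof -
  let ?o = "orient x y"
  define p where "p s = ?o (s + 1) (s + 2) (s + 4) * ?o s (s + 5) (s + 6) /
      (?o s (s + 1) (s + 2) * ?o (s + 4) (s + 5) (s + 6))" for s
  define q where "q s = ?o (s + 3) (s + 5) (s + 6) * ?o s (s + 1) (s + 2) /
      (?o s (s + 5) (s + 6) * ?o (s + 1) (s + 2) (s + 3))" for s
  have "\<exists>s. 1 \<le> p s \<and> 1 \<le> q s"
  proof (rule periodic_both_ge_one)
    fix s
    show "0 < p s" "0 < q s"
      by (simp_all add: p_def q_def pos)
    have "x (s + 7 + t) = x (s + t)" "y (s + 7 + t) = y (s + t)" for t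
      using per[of "s + t"] by (simp_all only: add.assoc add.commute[of 7])
    note shift = this
    show "p (s + 7) = p s" "q (s + 7) = q s"
      unfolding p_def q_def orient_def per shift by (rule refl)+
    have e: "s + 1 + 1 = s + 2" "s + 1 + 2 = s + 3" "s + 1 + 3 = s + 4" "s + 1 + 4 = s + 5"
        "s + 1 + 5 = s + 6" "s + 1 + 6 = s + 7" "s + 2 + 1 = s + 3" "s + 2 + 2 = s + 4"
        "s + 2 + 4 = s + 6" "s + 2 + 5 = s + 7" "s + 2 + 6 = s + 8" "s + 1 + 7 = s + 8"
      by simp_all
    have xy: "x (s + 7) = x s" "x (s + 8) = x (s + 1)" "y (s + 7) = y s" "y (s + 8) = y (s + 1)"
      using per[of s] per[of "s + 1"] unfolding e by -
    have rot: "?o (s + 1) (s + 6) (s + 7) = ?o s (s + 1) (s + 6)"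
        "?o (s + 2) (s + 7) (s + 8) = ?o s (s + 1) (s + 2)"
        "?o (s + 5) (s + 6) (s + 7) = ?o s (s + 5) (s + 6)"
        "?o (s + 6) (s + 7) (s + 8) = ?o s (s + 1) (s + 6)"
        "?o (s + 4) (s + 6) (s + 7) = ?o s (s + 4) (s + 6)"
      unfolding orient_def xy by (simp_all add: algebra_simps)
    have p1: "p (s + 1) = ?o (s + 2) (s + 3) (s + 5) * ?o s (s + 1) (s + 6) /
        (?o (s + 1) (s + 2) (s + 3) * ?o s (s + 5) (s + 6))"
      unfolding p_def e rot ..
    have p2: "p (s + 2) = ?o (s + 3) (s + 4) (s + 6) * ?o s (s + 1) (s + 2) /
        (?o (s + 2) (s + 3) (s + 4) * ?o s (s + 1) (s + 6))"
      unfolding p_def e rot ..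
    have q1: "q (s + 1) = ?o s (s + 4) (s + 6) * ?o (s + 1) (s + 2) (s + 3) /
        (?o s (s + 1) (s + 6) * ?o (s + 2) (s + 3) (s + 4))"
      unfolding q_def e rot ..
    \<comment> \<open>The term dropped from the relation of the vertices \<open>s + 2\<close>, ...,
      \<open>s + 6\<close>.\<close>
    have "0 < ?o (s + 2) (s + 3) (s + 6) * ?o (s + 3) (s + 4) (s + 5)"
      by (simp add: pos)
    then have less: "?o (s + 3) (s + 5) (s + 6) * ?o (s + 2) (s + 3) (s + 4)
        < ?o (s + 2) (s + 3) (s + 5) * ?o (s + 3) (s + 4) (s + 6)"
      unfolding orient_plucker(1)[of x y "s + 2" "s + 3" "s + 5" "s + 4" "s + 6"]
      by (simp add: mult.commute)
    have eq1: "p (s + 1) * p (s + 2) = (?o s (s + 1) (s + 2) / (?o s (s + 5) (s + 6) * ?o (s + 1) (s + 2) (s + 3))) *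
        ((?o (s + 2) (s + 3) (s + 5) * ?o (s + 3) (s + 4) (s + 6)) / ?o (s + 2) (s + 3) (s + 4))"
      using pos[of s "s + 1" "s + 6"] unfolding p1 p2 by (simp add: mult_ac)
    have eq2: "q s = (?o s (s + 1) (s + 2) / (?o s (s + 5) (s + 6) * ?o (s + 1) (s + 2) (s + 3))) *
        ?o (s + 3) (s + 5) (s + 6)"
      unfolding q_def by simp
    have lt: "?o (s + 3) (s + 5) (s + 6)
        < (?o (s + 2) (s + 3) (s + 5) * ?o (s + 3) (s + 4) (s + 6)) / ?o (s + 2) (s + 3) (s + 4)"
      using less pos[of "s + 2" "s + 3" "s + 4"] by (simp add: less_divide_eq)
    show "q s < p (s + 1) * p (s + 2)"
      unfolding eq1 eq2 by (rule mult_strict_left_mono[OF lt]) (simp add: pos)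
    \<comment> \<open>The term dropped from the relation of the vertices \<open>s\<close>,
      \<open>s + 3\<close>, ..., \<open>s + 6\<close>.\<close>
    have "0 < ?o (s + 4) (s + 5) (s + 6) * ?o s (s + 3) (s + 6)"
      by (simp add: pos)
    then have less: "?o (s + 3) (s + 4) (s + 6) * ?o s (s + 5) (s + 6)
        < ?o (s + 3) (s + 5) (s + 6) * ?o s (s + 4) (s + 6)"
      unfolding orient_plucker(2)[of x y "s + 3" "s + 5" "s + 6" s "s + 4"]
      by simp
    have eq1: "q s * q (s + 1) = (?o s (s + 1) (s + 2) / (?o (s + 2) (s + 3) (s + 4) * ?o s (s + 1) (s + 6))) *
        ((?o (s + 3) (s + 5) (s + 6) * ?o s (s + 4) (s + 6)) / ?o s (s + 5) (s + 6))"
      using pos[of "s + 1" "s + 2" "s + 3"] unfolding q1 q_def[of s] by (simp add: mult_ac)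
    have eq2: "p (s + 2) = (?o s (s + 1) (s + 2) / (?o (s + 2) (s + 3) (s + 4) * ?o s (s + 1) (s + 6))) *
        ?o (s + 3) (s + 4) (s + 6)"
      unfolding p2 by simp
    have lt: "?o (s + 3) (s + 4) (s + 6)
        < (?o (s + 3) (s + 5) (s + 6) * ?o s (s + 4) (s + 6)) / ?o s (s + 5) (s + 6)"
      using less pos[of s "s + 5" "s + 6"] by (simp add: less_divide_eq)
    show "p (s + 2) < q s * q (s + 1)"
      unfolding eq1 eq2 by (rule mult_strict_left_mono[OF lt]) (simp add: pos)
  qed
  then obtain s where "1 \<le> p s" "1 \<le> q s" by blast
  then have "?o s (s + 1) (s + 2) * ?o (s + 4) (s + 5) (s + 6)
        \<le> ?o (s + 1) (s + 2) (s + 4) * ?o s (s + 5) (s + 6)"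
     "?o s (s + 5) (s + 6) * ?o (s + 1) (s + 2) (s + 3)
        \<le> ?o (s + 3) (s + 5) (s + 6) * ?o s (s + 1) (s + 2)"
    by (simp_all add: p_def q_def le_divide_eq pos)
  then show ?thesis by blast
qed

lemma nn_fac_scale:
  assumes "nn_fac R J k a" and "\<And>j. j \<in> J \<Longrightarrow> 0 \<le> s j"
  shows "nn_fac R J k (\<lambda>i j. s j * a i j)"
proof (rule nn_facE[OF assms(1)])
  fix B C
  assume B: "\<And>i t. i \<in> R \<Longrightarrow> t < k \<Longrightarrow> 0 \<le> B i t"
    and C: "\<And>t j. t < k \<Longrightarrow> j \<in> J \<Longrightarrow> 0 \<le> C t j"
    and BC: "\<And>i j. i \<in> R \<Longrightarrow> j \<in> J \<Longrightarrow> a i j = (\<Sum>t<k. B i t * C t j)"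
  show ?thesis
  proof (rule nn_facI[where B = B and C = "\<lambda>t j. s j * C t j"])
    show "s j * a i j = (\<Sum>t<k. B i t * (s j * C t j))" if "i \<in> R" "j \<in> J" for i j
      unfolding BC[OF that] by (simp add: sum_distrib_left mult.left_commute)
  qed (use B C assms(2) in auto)
qed

lemma nn_fac_convex_heptagon:
  fixes x y :: "nat \<Rightarrow> real"
  assumes pos: "\<And>i j k. i < j \<Longrightarrow> j < k \<Longrightarrow> k < 7 \<Longrightarrow> 0 < orient x y i j k"
    and a: "\<And>i j. a i j = al i + be i * x j + ga i * y j"
    and nonneg: "\<And>i j. i \<in> R \<Longrightarrow> j < 7 \<Longrightarrow> 0 \<le> a i j"
  shows "nn_fac R {..<7} 6 a"
proof -
  define X Y where "X i = x (i mod 7)" and "Y i = y (i mod 7)" for i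
  have per: "X (i + 7) = X i" "Y (i + 7) = Y i" for i
    by (simp_all add: X_def Y_def)
  have "0 < orient X Y i j k" if "i < j" "j < k" "k < 7" for i j k
    using pos[OF that] that by (simp add: X_def Y_def orient_def)
  then have pos': "0 < orient X Y i j k" if "i < j" "j < k" "k < i + 7" for i j k
    using that by (rule orient_periodic_pos[of X Y, OF _ per])
  obtain s where s:
    "orient X Y s (s + 1) (s + 2) * orient X Y (s + 4) (s + 5) (s + 6)
        \<le> orient X Y (s + 1) (s + 2) (s + 4) * orient X Y s (s + 5) (s + 6)"
    "orient X Y s (s + 5) (s + 6) * orient X Y (s + 1) (s + 2) (s + 3)
        \<le> orient X Y (s + 3) (s + 5) (s + 6) * orient X Y s (s + 1) (s + 2)"
    using good_rotation[of X Y, OF pos' per] by blast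
  define h where "h j = (s + j) mod 7" for j
  have sh: "orient (\<lambda>j. X (s + j)) (\<lambda>j. Y (s + j)) i j k = orient X Y (s + i) (s + j) (s + k)" for i j k
    by (simp add: orient_def)
  have "nn_fac R {..<7} 6 (\<lambda>i j. a i (h j))"
  proof (rule nn_fac_good_heptagon[where x = "\<lambda>j. X (s + j)" and y = "\<lambda>j. Y (s + j)"])
    show "0 < orient (\<lambda>j. X (s + j)) (\<lambda>j. Y (s + j)) i j k" if "i < j" "j < k" "k < 7" for i j k
      unfolding sh using that by (intro pos') auto
    show "a i (h j) = al i + be i * X (s + j) + ga i * Y (s + j)" for i j
      by (simp add: a X_def Y_def h_def)
    show "0 \<le> a i (h j)" if "i \<in> R" for i j
      using nonneg[OF that] by (simp add: h_def)
  qed (use s in \<open>simp_all only: sh add_0_right\<close>)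
  then have "nn_fac R (h ` {..<7}) 6 a"
    by (rule nn_fac_image)
  moreover have "h ` {..<7} = {..<7}"
  proof
    show "{..<7} \<subseteq> h ` {..<7}"
    proof
      fix j :: nat
      assume "j \<in> {..<7}"
      \<comment> \<open>\<open>6 * s\<close> is \<open>- s\<close> modulo 7, so this index undoes
        the rotation \<open>h\<close>.\<close>
      then have "h ((j + 6 * s) mod 7) = j"
        unfolding h_def mod_add_right_eq by (simp add: mod_simps)
      then show "j \<in> h ` {..<7}" by (metis imageI lessThan_iff mod_less_divisor zero_less_numeral)
    qed
  qed (auto simp: h_def)
  ultimately show ?thesis by simp
qed

section \<open>Counterclockwise enumeration of points in convex position\<close>

lemma lexicographic_minimum:
  fixes x y :: "'a \<Rightarrow> real"
  assumes "finite J" "J \<noteq> {}"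
  obtains m where "m \<in> J" "\<And>j. j \<in> J \<Longrightarrow> x m < x j \<or> x m = x j \<and> y m \<le> y j"
proof -
  obtain b where b: "b \<in> J" "\<And>j. j \<in> J \<Longrightarrow> x b \<le> x j"
    using ex_is_arg_min_if_finite[of J x] assms by (auto simp: is_arg_min_def not_less)
  obtain m where m: "m \<in> {j \<in> J. x j = x b}" "\<And>j. j \<in> {j \<in> J. x j = x b} \<Longrightarrow> y m \<le> y j"
    using ex_is_arg_min_if_finite[of "{j \<in> J. x j = x b}" y] assms(1) b(1)
    by (auto simp: is_arg_min_def not_less)
  show ?thesis
    by (rule that[of m]) (use b m in force)+
qed

text \<open>Sort the points by angle around the lexicographically least point \<open>m\<close>, as
  in Graham's scan. By \<open>irr\<close>, no point lies in a possibly degenerate triangle of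
  others, which excludes ties in the angle and clockwise turns.\<close>

lemma convex_position_enumeration:
  fixes x y :: "'a \<Rightarrow> real"
  assumes "finite J"
    and irr: "\<And>j j1 j2 j3 c1 c2 c3. j \<in> J \<Longrightarrow> {j1, j2, j3} \<subseteq> J - {j} \<Longrightarrow>
      0 \<le> c1 \<Longrightarrow> 0 \<le> c2 \<Longrightarrow> 0 \<le> c3 \<Longrightarrow> c1 + c2 + c3 = 1 \<Longrightarrow>
      x j = c1 * x j1 + c2 * x j2 + c3 * x j3 \<Longrightarrow>
      y j = c1 * y j1 + c2 * y j2 + c3 * y j3 \<Longrightarrow> False"
  shows "\<exists>zs. distinct zs \<and> set zs = J \<and>
    (\<forall>i j k. i < j \<longrightarrow> j < k \<longrightarrow> k < length zs \<longrightarrow> 0 < orient x y (zs ! i) (zs ! j) (zs ! k))"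
proof (cases "J = {}")
  case True
  then show ?thesis by (intro exI[of _ "[]"]) simp
next
  case False
  obtain m where m: "m \<in> J" "\<And>j. j \<in> J \<Longrightarrow> x m < x j \<or> x m = x j \<and> y m \<le> y j"
    using lexicographic_minimum[OF assms(1) False] by blast
  let ?o = "orient x y"
  define dx dy where "dx j = x j - x m" and "dy j = y j - y m" for j
  have om: "?o m j k = dx j * dy k - dx k * dy j" for j k
    by (simp add: orient_def dx_def dy_def)
  have lex: "0 < dx j \<or> dx j = 0 \<and> 0 < dy j" if "j \<in> J - {m}" for j
  proof -
    have "x j \<noteq> x m \<or> y j \<noteq> y m"
      using irr[of j m m m 1 0 0] m(1) that by auto
    then show ?thesis
      using m(2)[of j] that by (auto simp: dx_def dy_def)
  qed
  \<comment> \<open>Two points collinear with \<open>m\<close> lie on one ray from \<open>m\<close>,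
    since all directions are in a half-open half-plane; the nearer one is then on the segment from
    \<open>m\<close> to the other.\<close>
  have nonflat: "?o m j k \<noteq> 0" if jk: "j \<in> J - {m}" "k \<in> J - {m}" "j \<noteq> k" for j k
  proof
    assume 0: "?o m j k = 0"
    have "\<exists>t>0. dx j = t * dx k \<and> dy j = t * dy k"
    proof (cases "dx k = 0")
      case True
      then have "0 < dy k" using lex[OF jk(2)] by simp
      moreover from this True have "dx j = 0" using 0 by (simp add: om)
      moreover from this have "0 < dy j" using lex[OF jk(1)] by simp
      ultimately show ?thesis using True by (intro exI[of _ "dy j / dy k"]) simp
    next
      case False
      then have k: "0 < dx k" using lex[OF jk(2)] by auto
      have "dx j \<noteq> 0"
        using 0 k lex[OF jk(1)] by (auto simp: om)
      then have "0 < dx j" using lex[OF jk(1)] by auto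
      then show ?thesis using 0 k
        by (intro exI[of _ "dx j / dx k"]) (simp add: om field_simps)
    qed
    then obtain t where t: "0 < t" "dx j = t * dx k" "dy j = t * dy k" by blast
    show False
    proof (cases "t \<le> 1")
      case True
      show False
        by (rule irr[of j k m m t "1 - t" 0])
          (use t True jk m(1) in \<open>auto simp: dx_def dy_def algebra_simps\<close>)
    next
      case False
      then have "dx k = 1 / t * dx j" "dy k = 1 / t * dy j" using t by auto
      then show False
        by (intro irr[of k j m m "1 / t" "1 - 1 / t" 0])
          (use t False jk m(1) in \<open>auto simp: dx_def dy_def algebra_simps\<close>)
    qed
  qed
  have trans: "0 < ?o m i k" if S: "i \<in> J - {m}" "j \<in> J - {m}" "k \<in> J - {m}"
    and ij: "0 < ?o m i j" and jk: "0 < ?o m j k" for i j k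
  proof (rule ccontr)
    assume "\<not> 0 < ?o m i k"
    then have ki: "0 \<le> - ?o m i k" by simp
    \<comment> \<open>In this linear relation all weights and all \<open>dx\<close> would be
      nonnegative, so \<open>i\<close> and \<open>k\<close> would lie straight above
      \<open>m\<close>; but then \<open>j\<close>, to the right, is clockwise from
      \<open>i\<close>.\<close>
    have "?o m j k * dx i + - ?o m i k * dx j + ?o m i j * dx k = 0"
      and "?o m j k * dy i + - ?o m i k * dy j + ?o m i j * dy k = 0"
      by (simp_all add: om algebra_simps)
    moreover have "0 \<le> dx i" "0 \<le> dx j" "0 \<le> dx k" using lex S by force+
    ultimately have dxz: "?o m j k * dx i = 0" "?o m i j * dx k = 0"
      using ij jk ki by (smt (verit) mult_nonneg_nonneg)+
    then have "dx i = 0" "dx k = 0" using ij jk by auto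
    then have "0 < dy i" "0 < dy k" using lex S by force+
    moreover have "dx j \<noteq> 0" using ij \<open>dx i = 0\<close> by (auto simp: om)
    then have "0 < dx j" using lex[OF S(2)] by auto
    ultimately have "?o m i j < 0" using \<open>dx i = 0\<close> by (simp add: om)
    then show False using ij by simp
  qed
  have "\<exists>zs. distinct zs \<and> set zs = J - {m} \<and> sorted_wrt (\<lambda>j k. 0 < ?o m j k) zs"
  proof (rule sorted_enumeration)
    show "0 < ?o m j k \<or> 0 < ?o m k j" if "j \<in> J - {m}" "k \<in> J - {m}" "j \<noteq> k" for j k
      using nonflat[OF that] orient_swap[of x y m j k] by linarith
  qed (use assms(1) trans in blast)+
  then obtain zs where zs: "distinct zs" "set zs = J - {m}" "sorted_wrt (\<lambda>j k. 0 < ?o m j k) zs"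
    by blast
  have tri: "0 < ?o u v w" if S: "u \<in> J - {m}" "v \<in> J - {m}" "w \<in> J - {m}"
    and uv: "0 < ?o m u v" and vw: "0 < ?o m v w" and uw: "0 < ?o m u w" for u v w
  proof (rule ccontr)
    assume neg: "\<not> 0 < ?o u v w"
    \<comment> \<open>For the functions 1, \<open>x\<close> and \<open>y\<close> this gives the
      barycentric coordinates of \<open>v\<close> in the triangle \<open>u, w, m\<close>; without a
      left turn at \<open>v\<close> they are all nonnegative.\<close>
    have aff: "al + be * x v + ga * y v =
        ?o m v w / ?o m u w * (al + be * x u + ga * y u) + ?o m u v / ?o m u w * (al + be * x w + ga * y w)
        + - ?o u v w / ?o m u w * (al + be * x m + ga * y m)"
      (is "?g v = _ * ?g u + _ * ?g w + _ * ?g m") for al be ga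
    proof -
      have "?g v = (?o m v w * ?g u + ?o m u v * ?g w + - ?o u v w * ?g m) / ?o m u w"
        using orient_affine[of x y u v w al be m ga] uw by (simp add: eq_divide_eq mult.commute)
      then show ?thesis
        by (simp add: add_divide_distrib diff_divide_distrib)
    qed
    have "u \<noteq> v" "w \<noteq> v" using uv vw by (auto simp: om)
    show False
    proof (rule irr[of v u w m])
      show "{u, w, m} \<subseteq> J - {v}" using S m(1) \<open>u \<noteq> v\<close> \<open>w \<noteq> v\<close> by auto
      show "?o m v w / ?o m u w + ?o m u v / ?o m u w + - ?o u v w / ?o m u w = 1"
        using aff[of 1 0 0] by simp
      show "x v = ?o m v w / ?o m u w * x u + ?o m u v / ?o m u w * x w + - ?o u v w / ?o m u w * x m"
        using aff[of 0 1 0] by simp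
      show "y v = ?o m v w / ?o m u w * y u + ?o m u v / ?o m u w * y w + - ?o u v w / ?o m u w * y m"
        using aff[of 0 0 1] by simp
    qed (use S neg uv vw uw in \<open>auto simp: divide_nonneg_pos divide_nonpos_pos\<close>)
  qed
  have "0 < ?o ((m # zs) ! i) ((m # zs) ! j) ((m # zs) ! k)"
    if ijk: "i < j" "j < k" "k < length (m # zs)" for i j k
  proof -
    obtain j' k' where j': "j = Suc j'" and k': "k = Suc k'"
      using ijk by (metis less_imp_Suc_add)
    have r: "0 < ?o m (zs ! i) (zs ! j)" if "i < j" "j < length zs" for i j
      using sorted_wrt_nth_less[OF zs(3) that] .
    show ?thesis
    proof (cases i)
      case 0
      then show ?thesis using r[of j' k'] ijk j' k' by simp
    next
      case (Suc i')
      have "zs ! l \<in> J - {m}" if "l < length zs" for l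
        using that zs(2) nth_mem by blast
      then show ?thesis
        using tri[of "zs ! i'" "zs ! j'" "zs ! k'"] r[of i' j'] r[of j' k'] r[of i' k'] ijk j' k' Suc
        by simp
    qed
  qed
  moreover have "distinct (m # zs)" "set (m # zs) = J"
    using zs(1,2) m(1) by auto
  ultimately show ?thesis by blast
qed

section \<open>From planar points to seven columns of rank at most three\<close>

text \<open>A point in a triangle of others would make its column a conic combination of theirs and
  so give size six at once; otherwise the points form a convex heptagon.\<close>

lemma nn_fac_affine_seven:
  fixes x y :: "'c \<Rightarrow> real"
  assumes card: "card J = 7"
    and a: "\<And>i j. a i j = al i + be i * x j + ga i * y j"
    and nonneg: "\<And>i j. i \<in> R \<Longrightarrow> j \<in> J \<Longrightarrow> 0 \<le> a i j"
  shows "nn_fac R J 6 a"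
proof (rule ccontr)
  assume not: "\<not> nn_fac R J 6 a"
  have fin: "finite J" using card by (simp add: card_ge_0_finite)
  have "\<exists>zs. distinct zs \<and> set zs = J \<and>
    (\<forall>i j k. i < j \<longrightarrow> j < k \<longrightarrow> k < length zs \<longrightarrow> 0 < orient x y (zs ! i) (zs ! j) (zs ! k))"
  proof (rule convex_position_enumeration[OF fin])
    fix j j1 j2 j3 c1 c2 c3
    assume j: "j \<in> J" "{j1, j2, j3} \<subseteq> J - {j}" and c: "0 \<le> c1" "0 \<le> c2" "0 \<le> c3"
      and 1: "c1 + c2 + c3 = 1"
      and xy: "x j = c1 * x j1 + c2 * x j2 + c3 * x j3" "y j = c1 * y j1 + c2 * y j2 + c3 * y j3"
    have "a i j = c1 * a i j1 + c2 * a i j2 + c3 * a i j3" for i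
    proof -
      have "al i = c1 * al i + c2 * al i + c3 * al i"
        using 1 by (metis distrib_right mult_1)
      then show ?thesis
        unfolding a xy by (simp add: algebra_simps)
    qed
    then have "nn_fac R J (card J - 1) a"
      using fin nonneg j c by (intro nn_fac_conic[of J R a j j1 j2 j3 c1 c2 c3]) auto
    with not card show False by simp
  qed
  then obtain zs where zs: "distinct zs" "set zs = J" and
    pos: "\<And>i j k. i < j \<Longrightarrow> j < k \<Longrightarrow> k < length zs \<Longrightarrow> 0 < orient x y (zs ! i) (zs ! j) (zs ! k)"
    by blast
  have len: "length zs = 7"
    using zs card distinct_card by force
  have "nn_fac R {..<7} 6 (\<lambda>i j. a i (zs ! j))"
  proof (rule nn_fac_convex_heptagon)
    show "0 < orient (\<lambda>j. x (zs ! j)) (\<lambda>j. y (zs ! j)) i j k" if "i < j" "j < k" "k < 7" for i j k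
      using pos[OF that(1,2)] that(3) len by (simp add: orient_def)
    show "a i (zs ! j) = al i + be i * x (zs ! j) + ga i * y (zs ! j)" for i j
      by (rule a)
    show "0 \<le> a i (zs ! j)" if "i \<in> R" "j < 7" for i j
      using nonneg[OF that(1)] that(2) len zs(2) by auto
  qed
  then have "nn_fac R ((!) zs ` {..<7}) 6 a"
    by (rule nn_fac_image)
  moreover have "(!) zs ` {..<7} = J"
    using zs(2) len by (auto simp: set_conv_nth)
  ultimately show False using not by simp
qed

text \<open>Covers the columns that cannot be scaled to sum one.\<close>

lemma nn_fac_zero_column:
  assumes "card J = 7" and "\<And>i j. i \<in> R \<Longrightarrow> j \<in> J \<Longrightarrow> 0 \<le> a i j"
    and "j \<in> J" and "\<And>i. i \<in> R \<Longrightarrow> a i j = 0"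
  shows "nn_fac R J 6 a"
proof -
  have fin: "finite J" using assms(1) by (simp add: card_ge_0_finite)
  have "J - {j} \<noteq> {}"
  proof
    assume "J - {j} = {}"
    then have "card J \<le> card {j}" by (intro card_mono) auto
    with assms(1) show False by simp
  qed
  then obtain j' where "j' \<in> J - {j}" by blast
  then have "nn_fac R J (card J - 1) a"
    using fin assms by (intro nn_fac_conic[of J R a j j' j' j' 0 0 0]) auto
  then show ?thesis using assms(1) by simp
qed

text \<open>After scaling the columns to sum one, the sum condition is a linear equation in the
  coordinates \<open>V0\<close>, \<open>V1\<close>, \<open>V2\<close> with coefficient
  \<open>sum U0 R\<close> at \<open>V0\<close>. Solving it for \<open>V0\<close> makes each row
  affine in the other two.\<close>

lemma nn_fac_seven_aux:
  fixes U0 U1 U2 :: "'r \<Rightarrow> real"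
  assumes card: "card J = 7"
    and a: "\<And>i j. i \<in> R \<Longrightarrow> j \<in> J \<Longrightarrow> a i j = U0 i * V0 j + U1 i * V1 j + U2 i * V2 j"
    and nonneg: "\<And>i j. i \<in> R \<Longrightarrow> j \<in> J \<Longrightarrow> 0 \<le> a i j"
    and pos: "\<And>j. j \<in> J \<Longrightarrow> 0 < (\<Sum>i\<in>R. a i j)"
    and nz: "sum U0 R \<noteq> 0"
  shows "nn_fac R J 6 a"
proof -
  define s where "s j = (\<Sum>i\<in>R. a i j)" for j
  define f0 f1 f2 where "f0 = sum U0 R" and "f1 = sum U1 R" and "f2 = sum U2 R"
  have s: "s j = f0 * V0 j + f1 * V1 j + f2 * V2 j" if "j \<in> J" for j
    using that by (simp add: s_def f0_def f1_def f2_def a sum.distrib sum_distrib_right)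
  define b where "b i j = U0 i / f0 + (U1 i - U0 i * f1 / f0) * (V1 j / s j)
      + (U2 i - U0 i * f2 / f0) * (V2 j / s j)" for i j
  have sb: "s j * b i j = a i j" if "i \<in> R" "j \<in> J" for i j
  proof -
    have "s j \<noteq> 0" "f0 \<noteq> 0" using pos[OF that(2)] nz by (auto simp: s_def f0_def)
    then have "s j * b i j = (U0 i * s j + (U1 i * f0 - U0 i * f1) * V1 j + (U2 i * f0 - U0 i * f2) * V2 j) / f0"
      by (simp add: b_def field_simps)
    also have "U0 i * s j + (U1 i * f0 - U0 i * f1) * V1 j + (U2 i * f0 - U0 i * f2) * V2 j = f0 * a i j"
      unfolding s[OF that(2)] a[OF that] by (simp add: algebra_simps)
    finally show ?thesis using \<open>f0 \<noteq> 0\<close> by simp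
  qed
  have "nn_fac R J 6 b"
  proof (rule nn_fac_affine_seven[OF card])
    show "b i j = U0 i / f0 + (U1 i - U0 i * f1 / f0) * (V1 j / s j)
      + (U2 i - U0 i * f2 / f0) * (V2 j / s j)" for i j
      by (rule b_def)
    show "0 \<le> b i j" if "i \<in> R" "j \<in> J" for i j
      using sb[OF that] nonneg[OF that] pos[OF that(2)] unfolding s_def[symmetric]
      by (metis less_le_not_le zero_le_mult_iff)
  qed
  then have "nn_fac R J 6 (\<lambda>i j. s j * b i j)"
    using pos by (intro nn_fac_scale) (auto simp: s_def less_imp_le)
  then show ?thesis using sb by (rule nn_fac_cong)
qed

lemma nn_fac_seven:
  fixes U :: "'r \<Rightarrow> nat \<Rightarrow> real"
  assumes R: "finite R" and card: "card J = 7"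
    and a: "\<And>i j. i \<in> R \<Longrightarrow> j \<in> J \<Longrightarrow> a i j = (\<Sum>k<3. U i k * V k j)"
    and nonneg: "\<And>i j. i \<in> R \<Longrightarrow> j \<in> J \<Longrightarrow> 0 \<le> a i j"
  shows "nn_fac R J 6 a"
proof (cases "\<exists>j\<in>J. (\<Sum>i\<in>R. a i j) = 0")
  case True
  then obtain j where j: "j \<in> J" "(\<Sum>i\<in>R. a i j) = 0" by blast
  then have "\<forall>i\<in>R. a i j = 0"
    using nonneg R by (simp add: sum_nonneg_eq_0_iff)
  then show ?thesis
    by (intro nn_fac_zero_column[OF card nonneg j(1)]) simp_all
next
  case False
  have pos: "0 < (\<Sum>i\<in>R. a i j)" if "j \<in> J" for j
  proof -
    have "0 \<le> (\<Sum>i\<in>R. a i j)"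
      by (intro sum_nonneg nonneg that)
    moreover have "(\<Sum>i\<in>R. a i j) \<noteq> 0"
      using False that by blast
    ultimately show ?thesis by linarith
  qed
  let ?f = "\<lambda>k. \<Sum>i\<in>R. U i k"
  have a3: "a i j = U i 0 * V 0 j + U i 1 * V 1 j + U i 2 * V 2 j" if "i \<in> R" "j \<in> J" for i j
    using a[OF that] by (simp add: eval_nat_numeral)
  have "J \<noteq> {}" using card by auto
  then obtain j where j: "j \<in> J" by blast
  have "?f 0 * V 0 j + ?f 1 * V 1 j + ?f 2 * V 2 j = (\<Sum>i\<in>R. a i j)"
    using j by (simp add: a3 sum.distrib sum_distrib_right)
  \<comment> \<open>A positive column sum forces one of the three coefficients to be nonzero;
    permuting the summands moves it to the front.\<close>
  with pos[OF j] have "\<not> (?f 0 = 0 \<and> ?f 1 = 0 \<and> ?f 2 = 0)"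
    by auto
  then consider "?f 0 \<noteq> 0" | "?f 1 \<noteq> 0" | "?f 2 \<noteq> 0"
    by blast
  then show ?thesis
  proof cases
    case 1
    show ?thesis by (rule nn_fac_seven_aux[OF card a3 nonneg pos 1])
  next
    case 2
    have "a i j = U i 1 * V 1 j + U i 0 * V 0 j + U i 2 * V 2 j" if "i \<in> R" "j \<in> J" for i j
      using a3[OF that] by simp
    then show ?thesis by (rule nn_fac_seven_aux[OF card _ nonneg pos 2])
  next
    case 3
    have "a i j = U i 2 * V 2 j + U i 0 * V 0 j + U i 1 * V 1 j" if "i \<in> R" "j \<in> J" for i j
      using a3[OF that] by simp
    then show ?thesis by (rule nn_fac_seven_aux[OF card _ nonneg pos 3])
  qed
qed

lemma nn_fac_rank_three:
  fixes U :: "'r \<Rightarrow> nat \<Rightarrow> real"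
  assumes "finite R"
    and "\<And>i j. i \<in> R \<Longrightarrow> j < n \<Longrightarrow> a i j = (\<Sum>k<3. U i k * V k j)"
    and "\<And>i j. i \<in> R \<Longrightarrow> j < n \<Longrightarrow> 0 \<le> a i j"
  shows "nn_fac R {..<n} (n - n div 7) a"
proof (rule nn_fac_blocks[OF assms(3)])
  show "nn_fac R J 6 a" if "J \<subseteq> {..<n}" "card J = 7" for J
    by (rule nn_fac_seven[OF assms(1) that(2)]) (use assms(2,3) that(1) in auto)
qed auto

section \<open>Matrix rank, and the bound by rows and by columns\<close>

text \<open>A maximal independent set of columns has \<open>rank A\<close> elements and spans every
  column; \<open>U\<close> lists its vectors and \<open>V\<close> the coordinates.\<close>

lemma (in vec_space) rank_factorization:
  assumes A: "A \<in> carrier_mat n nc"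
  shows "\<exists>U V. \<forall>i<n. \<forall>j<nc. A $$ (i, j) = (\<Sum>k<rank A. U i k * V k j)"
proof -
  let ?P = "\<lambda>T. T \<subseteq> set (cols A) \<and> lin_indpt T"
  have cols: "set (cols A) \<subseteq> carrier_vec n"
    using A cols_dim by blast
  have "lin_indpt {}"
    unfolding lin_dep_def by auto
  then obtain S where S: "finite S" "maximal S ?P"
    using maximal_exists_superset[of "set (cols A)" ?P "{}"] by auto
  then have SP: "S \<subseteq> set (cols A)" "lin_indpt S"
    by (auto simp: maximal_def)
  have Sc: "S \<subseteq> carrier_vec n" using SP(1) cols by blast
  have "v \<in> span S" if v: "v \<in> set (cols A)" for v
  proof (cases "v \<in> S")
    case True
    then show ?thesis using in_own_span[OF Sc] by blast
  next
    case False
    then have "\<not> ?P (S \<union> {v})"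
      using S(2) unfolding maximal_def by blast
    then have "lin_dep (S \<union> {v})" using SP(1) v by blast
    then show ?thesis
      using lin_dep_iff_in_span[of S v] SP(2) Sc v cols False by auto
  qed
  then have "\<exists>c. v = lincomb c S" if "v \<in> set (cols A)" for v
    using finite_span[OF S(1)] Sc that by auto
  then obtain c where c: "\<And>v. v \<in> set (cols A) \<Longrightarrow> v = lincomb (c v) S"
    by metis
  have "rank A = card S" by (rule rank_card_indpt[OF A S(2)])
  then obtain h where h: "bij_betw h {..<rank A} S"
    using ex_bij_betw_nat_finite[OF S(1)] by (metis lessThan_atLeast0)
  have "A $$ (i, j) = (\<Sum>k<rank A. h k $ i * c (col A j) (h k))" if "i < n" "j < nc" for i j
  proof -
    have "col A j \<in> set (cols A)" using that(2) A by (simp add: cols_def)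
    then have "col A j $ i = lincomb (c (col A j)) S $ i" using c by metis
    also have "\<dots> = (\<Sum>v\<in>S. c (col A j) v * v $ i)"
      by (rule lincomb_index[OF that(1) Sc])
    also have "\<dots> = (\<Sum>k<rank A. c (col A j) (h k) * h k $ i)"
      by (rule sum.reindex_bij_betw[OF h, symmetric])
    finally show ?thesis
      using that A by (simp add: mult.commute)
  qed
  then show ?thesis
    by (intro exI[of _ "\<lambda>i k. h k $ i"] exI[of _ "\<lambda>k j. c (col A j) (h k)"]) simp
qed

lemma nonneg_rank_le_nn_fac:
  assumes A: "A \<in> carrier_mat m n" and "nn_fac {..<m} {..<n} k (\<lambda>i j. A $$ (i, j))"
  shows "nonneg_rank A \<le> k"
proof (rule nn_facE[OF assms(2)])
  fix B C
  assume BC: "\<And>i t. i \<in> {..<m} \<Longrightarrow> t < k \<Longrightarrow> 0 \<le> B i t"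
    "\<And>t j. t < k \<Longrightarrow> j \<in> {..<n} \<Longrightarrow> 0 \<le> C t j"
    "\<And>i j. i \<in> {..<m} \<Longrightarrow> j \<in> {..<n} \<Longrightarrow> A $$ (i, j) = (\<Sum>t<k. B i t * C t j)"
  have "nonneg_factorization A k"
    unfolding nonneg_factorization_def
  proof (intro bexI conjI)
    show "A = mat m k (\<lambda>(i, t). B i t) * mat k n (\<lambda>(t, j). C t j)"
      by (rule eq_matI) (use A BC(3) in \<open>auto simp: scalar_prod_def lessThan_atLeast0\<close>)
  qed (use A BC(1,2) in \<open>auto simp: nonneg_mat_def\<close>)
  then show ?thesis
    unfolding nonneg_rank_def by (rule Least_le)
qed

theorem theorem3p2:
  fixes A :: "real mat" and m n :: nat
  assumes "A \<in> carrier_mat m n"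
    and "nonneg_mat A"
    and "vec_space.rank m A = 3"
  shows "int (nonneg_rank A) \<le> \<lceil>6 * real (min m n) / 7\<rceil>"
proof -
  let ?a = "\<lambda>i j. A $$ (i, j)"
  have nonneg: "0 \<le> ?a i j" if "i < m" "j < n" for i j
    using assms(1,2) that by (auto simp: nonneg_mat_def)
  have "\<exists>U V. \<forall>i<m. \<forall>j<n. ?a i j = (\<Sum>k<3::nat. U i k * V k j)"
    using vec_space.rank_factorization[OF assms(1)] unfolding assms(3) .
  then obtain U V where UV: "\<forall>i<m. \<forall>j<n. ?a i j = (\<Sum>k<3::nat. U i k * V k j)"
    by (elim exE)
  have "nn_fac {..<m} {..<n} (n - n div 7) ?a"
  proof (rule nn_fac_rank_three)
    show "?a i j = (\<Sum>k<3. U i k * V k j)" if "i \<in> {..<m}" "j < n" for i j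
      using UV that by blast
  qed (simp_all add: nonneg)
  then have 1: "nonneg_rank A \<le> n - n div 7"
    by (rule nonneg_rank_le_nn_fac[OF assms(1)])
  have "nn_fac {..<n} {..<m} (m - m div 7) (\<lambda>j i. ?a i j)"
  proof (rule nn_fac_rank_three)
    show "?a i j = (\<Sum>k<3. V k j * U i k)" if "j \<in> {..<n}" "i < m" for i j
      using UV that by (simp only: mult.commute[of "V _ _"] lessThan_iff)
  qed (simp_all add: nonneg)
  then have "nn_fac {..<m} {..<n} (m - m div 7) ?a"
    by (rule nn_fac_transpose)
  then have 2: "nonneg_rank A \<le> m - m div 7"
    by (rule nonneg_rank_le_nn_fac[OF assms(1)])
  have "real (k - k div 7) < 6 * real k / 7 + 1" for k :: nat
  proof -
    \<comment> \<open>The left side is \<open>6 * k + k mod 7\<close>. An integer below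
      \<open>6 * k / 7 + 1\<close> is at most the ceiling of \<open>6 * k / 7\<close>.\<close>
    have "7 * (k - k div 7) < 6 * k + 7"
      using div_mult_mod_eq[of k 7] mod_less_divisor[of 7 k] by linarith
    then have "real (7 * (k - k div 7)) < real (6 * k + 7)" by (simp only: of_nat_less_iff)
    then show ?thesis by simp
  qed
  then have ceil: "int (k - k div 7) \<le> \<lceil>6 * real k / 7\<rceil>" for k :: nat
    unfolding le_ceiling_iff of_int_of_nat_eq by (simp only: less_diff_eq diff_less_eq)
  show ?thesis
  proof (cases "m \<le> n")
    case True
    then show ?thesis using ceil[of m] 2 by simp
  next
    case False
    then show ?thesis using ceil[of n] 1 by simp
  qed
qed

end
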